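(* Let $\mathrm{CNOT1}=|0000\rangle+|0110\rangle+|1011\rangle+|1101\rangle$, a 4-arity gate. 1. There does not exist any invertible matrix $A\in\mathbb{C}^{2\times2}$ such that CNOT1 is Pfaffian under the homogeneous change of basis $A\otimes A\otimes A\otimes A$. 2. There do exist invertible matrices $A,B,C,D\in\mathbb{C}^{2\times2}$ such that CNOT1 is Pfaffian under the heterogeneous change of basis $A\otimes B\otimes C\otimes D$.
   Context: Let $V=\mathbb{C}^2$ with basis $|0\rangle,|1\rangle$. An $n$-arity gate is an element of $V^{\otimes n}$. For $I\subseteq[n]=\{1,\dots,n\}$, $|I\rangle$ denotes the basis ket whose bitstring is the indicator of $I$. Rows and columns of $2\times2$ matrices are indexed by $0,1$, and $M|j\rangle=M_{0j}|0\rangle+M_{1j}|1\rangle$. For an $n\times n$ complex skew-symmetric matrix $\Xi$ put $\mathrm{sPf}(\Xi)=\sum_{I\subseteq[n]}\mathrm{Pf}(\Xi|_I)|I\rangle$, where $\Xi|_I$ is the submatrix with rows and columns in $I$, and the Pfaffian $\mathrm{Pf}$ is $1$ for the empty matrix and $0$ for odd size. A gate $G$ of arity $n$ is Pfaffian under $A_1\otimes\cdots\otimes A_n$ if $(A_1\otimes\cdots\otimes A_n)G=\alpha\,\mathrm{sPf}(\Xi)$ for some $\alpha\in\mathbb{C}$ and skew-symmetric $\Xi\in\mathbb{C}^{n\times n}$. The tensor factors correspond to the wires $1,2,3,4$ around the vertex: wires 1, 2 are the inputs, wire 4 is the output of wire 1 (the control) and wire 3 is the output of wire 2. *)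

theory Defs
  imports
    "Jordan_Normal_Form.DL_Submatrix"
    "HOL-Combinatorics.Permutations"
    Complex_Main
begin

text \<open>
  An element of $V^{\otimes n}$ is represented by its coefficient function on bitstrings of
  length $n$ (lists over $\{0,1\}$, first tensor factor first), extended by 0 to all other lists.
  Wires are numbered from 0, so $[n]$ becomes \<open>{..<n}\<close>.
\<close>

type_synonym gate = "nat list \<Rightarrow> complex"

definition bitstrings :: "nat \<Rightarrow> nat list set" where
  "bitstrings n = {x. length x = n \<and> set x \<subseteq> {0, 1}}"

definition gates :: "nat \<Rightarrow> gate set" where
  "gates n = {G. \<forall>x. x \<notin> bitstrings n \<longrightarrow> G x = 0}"

definition ket :: "nat list \<Rightarrow> gate" where
  "ket x = (\<lambda>y. if y = x then 1 else 0)"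

definition indicator_string :: "nat \<Rightarrow> nat set \<Rightarrow> nat list" where
  "indicator_string n I = map (\<lambda>i. if i \<in> I then 1 else 0) [0..<n]"

text \<open>
  The linear action of $A_1\otimes\cdots\otimes A_n$. Since $M|j\rangle = M_{0j}|0\rangle + M_{1j}|1\rangle$,
  the matrix entry between $|y\rangle$ and $|x\rangle$ is $\prod_i (A_i)_{x_i y_i}$.
\<close>

definition tensor_apply :: "complex mat list \<Rightarrow> gate \<Rightarrow> gate" where
  "tensor_apply As G = (\<lambda>x. if x \<in> bitstrings (length As)
     then \<Sum>y\<in>bitstrings (length As). (\<Prod>i<length As. (As ! i) $$ (x ! i, y ! i)) * G y
     else 0)"

definition skew_symmetric :: "complex mat \<Rightarrow> bool" where
  "skew_symmetric M \<longleftrightarrow> square_mat M \<and> transpose_mat M = - M"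

definition Pf :: "complex mat \<Rightarrow> complex" where
  "Pf M = (let n = dim_row M in
     if odd n then 0
     else (\<Sum>p | p permutes {..<n}.
             of_int (sign p) * (\<Prod>i<n div 2. M $$ (p (2 * i), p (2 * i + 1))))
          / (2 ^ (n div 2) * fact (n div 2)))"

definition sPf :: "complex mat \<Rightarrow> gate" where
  "sPf M = (\<lambda>x. \<Sum>I\<in>Pow {..<dim_row M}.
     Pf (submatrix M I I) * ket (indicator_string (dim_row M) I) x)"

definition pfaffian_under :: "complex mat list \<Rightarrow> gate \<Rightarrow> bool" where
  "pfaffian_under As G \<longleftrightarrow>
     G \<in> gates (length As) \<and>
     (\<forall>M\<in>set As. M \<in> carrier_mat 2 2) \<and>
     (\<exists>\<alpha> \<Xi>. \<Xi> \<in> carrier_mat (length As) (length As) \<and> skew_symmetric \<Xi> \<and>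
        tensor_apply As G = (\<lambda>x. \<alpha> * sPf \<Xi> x))"

definition CNOT1 :: gate where
  "CNOT1 = (\<lambda>x. ket [0,0,0,0] x + ket [0,1,1,0] x + ket [1,0,1,1] x + ket [1,1,0,1] x)"

lemma CNOT1_in_gates: "CNOT1 \<in> gates 4"
  by (auto simp: CNOT1_def gates_def ket_def bitstrings_def)

lemma finite_bitstrings: "finite (bitstrings n)"
  using finite_lists_length_eq[of "{0, 1::nat}" n]
  by (simp add: bitstrings_def conj_commute)

lemma tensor_apply_ket:
  assumes "y \<in> bitstrings (length As)" "x \<in> bitstrings (length As)"
  shows "tensor_apply As (ket y) x = (\<Prod>i<length As. (As ! i) $$ (x ! i, y ! i))"
proof -
  have "(\<Sum>z\<in>bitstrings (length As). (\<Prod>i<length As. (As ! i) $$ (x ! i, z ! i)) * ket y z)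
      = (\<Sum>z\<in>bitstrings (length As). if z = y then \<Prod>i<length As. (As ! i) $$ (x ! i, z ! i) else 0)"
    by (rule sum.cong) (auto simp: ket_def)
  then show ?thesis
    using assms finite_bitstrings by (simp add: tensor_apply_def)
qed

lemma Pf_empty: "dim_row M = 0 \<Longrightarrow> Pf M = 1"
  by (simp add: Pf_def)

end

theory Submission
  imports Defs
begin

text \<open>
  Call the coefficient of a gate at the indicator string of \<open>I\<close> odd if \<open>card I\<close> is odd. Pfaffians
  of odd size vanish, so a Pfaffian gate has no odd coefficients in the transformed basis
  (\<open>pfaffian_under_imp_odd_zero\<close>), and in arity 4 a gate without odd coefficients, normalised so
  that its empty coefficient is 1, is an \<open>sPf\<close> as soon as the quartic coefficient is
  $\Xi_{01}\Xi_{23}-\Xi_{02}\Xi_{13}+\Xi_{03}\Xi_{12}$ (\<open>Pf_dim_4\<close>).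

  With the wires numbered from 1, the control bit has the same value on wires 1 and 4 and selects
  the identity or the bit flip between wires 2 and 3. Summing over its two values writes every coefficient of the transformed
  gate as a dot product of two vectors in $\mathbb{C}^2$, one depending on wires 1 and 4, the other
  on wires 2 and 3. Under a homogeneous basis change the rows $(p,q)$ and $(r,s)$ of one matrix enter
  both vectors, and four of the odd coefficients, once set to 0, already force $ps=qr$
  (\<open>odd_coefficients_force_singular\<close>). So parity alone is the obstruction.

  For the positive half, a gate has only even coefficients after the basis change exactly when
  $Z^{\otimes 4}$ fixes it, that is, when the original gate is fixed by
  $K_1\otimes K_2\otimes K_3\otimes K_4$ with involutions $K_i=A_i^{-1}ZA_i$. Such a symmetry of
  CNOT is $X\otimes Z\otimes Y\otimes(-Y)$; diagonalising these four matrices separately yields the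
  four witnesses. One row on wire 2 is rescaled to make the coefficients real, and the Pfaffian
  identity then reads $1-1-1=-1$.
\<close>

section \<open>Invertible two-by-two matrices\<close>

lemma invertible_mat_2x2_iff:
  fixes A :: "'a :: field mat"
  assumes A: "A \<in> carrier_mat 2 2"
  shows "invertible_mat A \<longleftrightarrow> A $$ (0,0) * A $$ (1,1) \<noteq> A $$ (0,1) * A $$ (1,0)"
    (is "_ \<longleftrightarrow> ?ad \<noteq> ?bc")
proof
  assume "invertible_mat A"
  then obtain B where AB: "A * B = 1\<^sub>m 2" and BA: "B * A = 1\<^sub>m (dim_row B)"
    using A by (auto simp: invertible_mat_def inverts_mat_def)
  have B: "B \<in> carrier_mat 2 2"
    using arg_cong[OF AB, of dim_col] arg_cong[OF BA, of dim_col] A by (intro carrier_matI) auto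
  have entry: "A $$ (i,0) * B $$ (0,j) + A $$ (i,1) * B $$ (1,j) = (if i = j then 1 else 0)"
    if "i < 2" "j < 2" for i j
    using arg_cong[OF AB, of "\<lambda>M. M $$ (i,j)"] A B that
    by (simp add: scalar_prod_def numeral_2_eq_2)
  \<comment> \<open>Multiplicativity of the determinant.\<close>
  have "(?ad - ?bc) * (B $$ (0,0) * B $$ (1,1) - B $$ (0,1) * B $$ (1,0))
      = (A $$ (0,0) * B $$ (0,0) + A $$ (0,1) * B $$ (1,0))
        * (A $$ (1,0) * B $$ (0,1) + A $$ (1,1) * B $$ (1,1))
      - (A $$ (0,0) * B $$ (0,1) + A $$ (0,1) * B $$ (1,1))
        * (A $$ (1,0) * B $$ (0,0) + A $$ (1,1) * B $$ (1,0))"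
    by (simp add: algebra_simps)
  also have "\<dots> = 1" by (simp add: entry del: One_nat_def)
  finally have "(?ad - ?bc) * (B $$ (0,0) * B $$ (1,1) - B $$ (0,1) * B $$ (1,0)) = 1" .
  then show "?ad \<noteq> ?bc" by auto
next
  assume ne: "?ad \<noteq> ?bc"
  define B where "B = mat_of_rows_list 2
    [[A $$ (1,1) / (?ad - ?bc), - A $$ (0,1) / (?ad - ?bc)],
     [- A $$ (1,0) / (?ad - ?bc), A $$ (0,0) / (?ad - ?bc)]]"
  have "A * B = 1\<^sub>m 2" "B * A = 1\<^sub>m 2"
    using A ne
    by (auto intro!: eq_matI simp: B_def mat_of_rows_list_def scalar_prod_def numeral_2_eq_2
        less_Suc_eq divide_simps)
  moreover have "dim_row B = 2" by (simp add: B_def mat_of_rows_list_def)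
  ultimately show "invertible_mat A"
    using A by (auto simp: invertible_mat_def inverts_mat_def)
qed

section \<open>Coefficients of a Pfaffian gate\<close>

lemma indicator_string_in_bitstrings: "indicator_string n I \<in> bitstrings n"
  by (auto simp: indicator_string_def bitstrings_def)

lemma indicator_string_nth:
  "i < n \<Longrightarrow> indicator_string n I ! i = (if i \<in> I then 1 else 0)"
  by (simp add: indicator_string_def)

lemma inj_on_indicator_string: "inj_on (indicator_string n) (Pow {..<n})"
proof (rule inj_onI)
  fix I J
  assume IJ: "I \<in> Pow {..<n}" "J \<in> Pow {..<n}"
    and eq: "indicator_string n I = indicator_string n J"
  have "i \<in> I \<longleftrightarrow> i \<in> J" if "i < n" for i
    using arg_cong[OF eq, of "\<lambda>x. x ! i"] that
    by (auto simp: indicator_string_nth split: if_splits)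
  then show "I = J" using IJ by blast
qed

lemma bitstrings_eq_indicator_strings: "bitstrings n = indicator_string n ` Pow {..<n}"
proof (intro equalityI subsetI)
  fix x assume x: "x \<in> bitstrings n"
  have "x ! i \<in> {0,1}" if "i < n" for i
  proof -
    have "x ! i \<in> set x" using x that by (simp add: bitstrings_def)
    then show ?thesis using x by (auto simp: bitstrings_def)
  qed
  then have "x = indicator_string n {i. i < n \<and> x ! i = 1}"
    using x by (intro nth_equalityI) (auto simp: bitstrings_def indicator_string_def)
  then show "x \<in> indicator_string n ` Pow {..<n}" by blast
qed (auto simp: indicator_string_in_bitstrings)

lemma sPf_indicator_string:
  assumes "I \<subseteq> {..<dim_row M}"
  shows "sPf M (indicator_string (dim_row M) I) = Pf (submatrix M I I)"
proof -
  have "sPf M (indicator_string (dim_row M) I)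
      = (\<Sum>J\<in>Pow {..<dim_row M}. if J = I then Pf (submatrix M J J) else 0)"
    unfolding sPf_def using assms inj_on_indicator_string[of "dim_row M"]
    by (intro sum.cong) (auto simp: ket_def inj_on_def)
  then show ?thesis using assms by simp
qed

lemma sPf_outside_bitstrings:
  "x \<notin> bitstrings (dim_row M) \<Longrightarrow> sPf M x = 0"
  unfolding sPf_def ket_def
  by (rule sum.neutral) (auto simp: indicator_string_in_bitstrings)

lemma dim_row_submatrix_subset:
  assumes "I \<subseteq> {..<dim_row M}"
  shows "dim_row (submatrix M I J) = card I"
proof -
  have "{i. i < dim_row M \<and> i \<in> I} = I" using assms by auto
  then show ?thesis by (simp add: dim_submatrix)
qed

lemma sPf_odd:
  assumes "I \<subseteq> {..<dim_row M}" "odd (card I)"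
  shows "sPf M (indicator_string (dim_row M) I) = 0"
  using assms by (simp add: sPf_indicator_string Pf_def dim_row_submatrix_subset)

lemma pfaffian_under_imp_odd_zero:
  assumes "pfaffian_under As G" "I \<subseteq> {..<length As}" "odd (card I)"
  shows "tensor_apply As G (indicator_string (length As) I) = 0"
proof -
  obtain \<alpha> \<Xi> where \<Xi>: "\<Xi> \<in> carrier_mat (length As) (length As)"
    and eq: "tensor_apply As G = (\<lambda>x. \<alpha> * sPf \<Xi> x)"
    using assms(1) by (auto simp: pfaffian_under_def)
  show ?thesis using sPf_odd[of I \<Xi>] \<Xi> assms(2,3) by (simp add: eq)
qed

lemma sPf_empty: "sPf M (indicator_string (dim_row M) {}) = 1"
  by (simp add: sPf_indicator_string Pf_empty dim_row_submatrix_subset)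

lemma skew_symmetric_entry:
  assumes "skew_symmetric M" "i < dim_row M" "j < dim_row M"
  shows "M $$ (j,i) = - M $$ (i,j)"
proof -
  have sq: "dim_col M = dim_row M" and eq: "transpose_mat M = - M"
    using assms(1) by (simp_all add: skew_symmetric_def)
  show ?thesis using arg_cong[OF eq, of "\<lambda>N. N $$ (i,j)"] assms(2,3) sq by simp
qed

lemma Pf_dim_2:
  assumes "dim_row M = 2" "M $$ (1,0) = - M $$ (0,1)"
  shows "Pf M = M $$ (0,1)"
proof -
  have f: "finite {1::nat}" "0 \<notin> {1::nat}" by auto
  have S: "{..<2} = {0, 1::nat}" by auto
  have "(\<Sum>p | p permutes {..<2}. of_int (sign p) * M $$ (p 0, p 1)) = 2 * M $$ (0,1)"
    unfolding S sum_over_permutations_insert[OF f] permutes_sing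
    using assms(2) by (simp add: sign_swap_id sign_id)
  then show ?thesis using assms(1) by (simp add: Pf_def)
qed

text \<open>
  Each of the three perfect matchings of $\{0,1,2,3\}$ arises from 8 of the 24 permutations (order
  of the two pairs, order inside each pair), all with equal contributions by skew-symmetry; this is
  the factor $2^2\cdot 2!$ divided out in \<open>Pf\<close>.
\<close>
lemma Pf_dim_4:
  assumes "dim_row M = 4" "skew_symmetric M"
  shows "Pf M = M $$ (0,1) * M $$ (2,3) - M $$ (0,2) * M $$ (1,3) + M $$ (0,3) * M $$ (1,2)"
proof -
  have skew: "M $$ (j,i) = - M $$ (i,j)" if "i < 4" "j < 4" for i j
    using that assms(1) by (intro skew_symmetric_entry[OF assms(2)]) simp_all
  have f: "finite {1,2,3::nat}" "0 \<notin> {1,2,3::nat}"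
    "finite {2,3::nat}" "1 \<notin> {2,3::nat}" "finite {3::nat}" "2 \<notin> {3::nat}" by auto
  have S: "{..<4} = {0,1,2,3::nat}" by auto
  have sum: "(\<Sum>p | p permutes {..<4}. of_int (sign p) * (M $$ (p 0, p 1) * M $$ (p 2, p 3)))
      = 8 * (M $$ (0,1) * M $$ (2,3) - M $$ (0,2) * M $$ (1,3) + M $$ (0,3) * M $$ (1,2))"
    unfolding S sum_over_permutations_insert[OF f(1,2)] sum_over_permutations_insert[OF f(3,4)]
      sum_over_permutations_insert[OF f(5,6)] permutes_sing
    using skew[of 0 1] skew[of 0 2] skew[of 0 3] skew[of 1 2] skew[of 1 3] skew[of 2 3]
    by (simp add: sign_swap_id permutation_swap_id permutation_compose sign_compose sign_id
        transpose_def algebra_simps)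
  have prod: "(\<Prod>i<4 div 2. M $$ (p (2 * i), p (2 * i + 1))) = M $$ (p 0, p 1) * M $$ (p 2, p 3)"
    for p :: "nat \<Rightarrow> nat"
  proof -
    have "{..<4 div 2} = {0, 1::nat}" by auto
    then show ?thesis by (simp add: numeral_3_eq_3)
  qed
  show ?thesis unfolding Pf_def Let_def assms(1) prod sum by simp
qed

lemma sPf_pair:
  assumes "skew_symmetric M" "i < j" "j < dim_row M"
  shows "sPf M (indicator_string (dim_row M) {i,j}) = M $$ (i,j)"
proof -
  let ?N = "submatrix M {i,j} {i,j}"
  have sq: "dim_col M = dim_row M" using assms(1) by (simp add: skew_symmetric_def)
  have card: "card {k. k < dim_row M \<and> k \<in> {i,j}} = 2"
  proof -
    have "{k. k < dim_row M \<and> k \<in> {i,j}} = {i,j}" using assms(2,3) by auto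
    then show ?thesis using assms(2) by simp
  qed
  have entry: "?N $$ (k,l) = M $$ (pick {i,j} k, pick {i,j} l)" if "k < 2" "l < 2" for k l
    using submatrix_index[of k M "{i,j}" l "{i,j}"] card sq that by simp
  have p0: "pick {i,j} 0 = i" using assms(2) by (auto intro: Least_equality)
  then have p1: "pick {i,j} 1 = j"
    using assms(2) by (auto simp del: pick.simps(1) intro: Least_equality)
  have "Pf ?N = ?N $$ (0,1)"
  proof (rule Pf_dim_2)
    show "?N $$ (1,0) = - ?N $$ (0,1)"
      using assms skew_symmetric_entry[OF assms(1), of i j]
      by (simp add: entry p0 p1 del: pick.simps One_nat_def)
  qed (simp only: dim_submatrix card)
  also have "\<dots> = M $$ (i,j)"
    by (simp add: entry p0 p1 del: pick.simps One_nat_def)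
  finally show ?thesis using assms by (simp add: sPf_indicator_string)
qed

lemma submatrix_all:
  assumes "I = {..<dim_row M}" "J = {..<dim_col M}"
  shows "submatrix M I J = M"
proof -
  have "pick {..<m} i = i" if "i < m" for m i
    using pick_reduce_set[of i m UNIV] that by (simp add: pick_UNIV lessThan_def)
  then show ?thesis
    using assms by (intro eq_matI) (auto simp: submatrix_def)
qed

lemma sPf_full:
  "square_mat M \<Longrightarrow> sPf M (indicator_string (dim_row M) {..<dim_row M}) = Pf M"
  by (simp add: sPf_indicator_string submatrix_all)

section \<open>Transforming the CNOT gate\<close>

lemma tensor_apply_CNOT1:
  assumes "{a, b, c, d} \<subseteq> {0, 1}"
  shows "tensor_apply [A, B, C, D] CNOT1 [a, b, c, d] =
      A $$ (a,0) * B $$ (b,0) * C $$ (c,0) * D $$ (d,0)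
    + A $$ (a,0) * B $$ (b,1) * C $$ (c,1) * D $$ (d,0)
    + A $$ (a,1) * B $$ (b,0) * C $$ (c,1) * D $$ (d,1)
    + A $$ (a,1) * B $$ (b,1) * C $$ (c,0) * D $$ (d,1)"
proof -
  let ?As = "[A, B, C, D]"
  let ?x = "[a, b, c, d]"
  have x: "?x \<in> bitstrings (length ?As)" using assms by (simp add: bitstrings_def)
  have add: "tensor_apply ?As (\<lambda>y. G y + H y) ?x = tensor_apply ?As G ?x + tensor_apply ?As H ?x"
    for G H
    by (simp add: tensor_apply_def distrib_left sum.distrib)
  have ket: "tensor_apply ?As (ket [i, j, k, l]) ?x
      = A $$ (a,i) * B $$ (b,j) * C $$ (c,k) * D $$ (d,l)" if "{i, j, k, l} \<subseteq> {0, 1}" for i j k l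
    using that tensor_apply_ket[OF _ x, of "[i, j, k, l]"]
    by (simp add: bitstrings_def eval_nat_numeral lessThan_Suc mult_ac)
  show ?thesis
    unfolding CNOT1_def add by (simp add: ket)
qed

section \<open>No homogeneous basis change\<close>

text \<open>
  Here $(p,q)$ and $(r,s)$ are the rows of the matrix, and the hypotheses are the coefficients at
  0010, 1011, 0001 and 0111, each a dot product of a vector from the control wires with one from the
  target wires. The first two are linear equations for the vector $(pr+qs,\,ps+qr)$ with determinant
  $p^2s^2-q^2r^2$. If that vector is nonzero, the determinant vanishes, and as $ps\neq qr$ this
  means $ps=-qr$; the vector is then $(pr+qs,0)$ and forces $p=r=0$. If it is zero, the last two
  equations become $pr(p-q)^2=pr(r-s)^2=0$, so $p=0$, $r=0$, or $p=q$ and $r=s$; each alternative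
  makes the rows dependent.
\<close>
lemma odd_coefficients_force_singular:
  fixes p q r s :: "'a :: idom"
  assumes e0010: "p\<^sup>2 * (p*r + q*s) + q\<^sup>2 * (p*s + q*r) = 0"
    and e1011: "r\<^sup>2 * (p*r + q*s) + s\<^sup>2 * (p*s + q*r) = 0"
    and e0001: "p*r * (p\<^sup>2 + q\<^sup>2) + q*s * (p*q + q*p) = 0"
    and e0111: "p*r * (r\<^sup>2 + s\<^sup>2) + q*s * (r*s + s*r) = 0"
  shows "p * s = q * r"
proof (rule ccontr)
  assume ne: "p * s \<noteq> q * r"
  show False
  proof (cases "p*r + q*s = 0 \<and> p*s + q*r = 0")
    case True
    then have qs: "q*s = - (p*r)" by (simp add: eq_neg_iff_add_eq_0 add.commute)
    have "p*r * (p - q)\<^sup>2 = 0" "p*r * (r - s)\<^sup>2 = 0"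
      using e0001 e0111 unfolding qs by (simp_all add: power2_eq_square algebra_simps)
    then consider "p = 0" | "r = 0" | "p = q" "r = s" by auto
    then show False using True ne by cases (auto simp: mult_ac)
  next
    case False
    \<comment> \<open>Cramer's rule for the two linear equations.\<close>
    have "(p*s - q*r) * (p*s + q*r) * (p*r + q*s)
        = s\<^sup>2 * (p\<^sup>2 * (p*r + q*s) + q\<^sup>2 * (p*s + q*r))
        - q\<^sup>2 * (r\<^sup>2 * (p*r + q*s) + s\<^sup>2 * (p*s + q*r))"
      and "(p*s - q*r) * (p*s + q*r) * (p*s + q*r)
        = p\<^sup>2 * (r\<^sup>2 * (p*r + q*s) + s\<^sup>2 * (p*s + q*r))
        - r\<^sup>2 * (p\<^sup>2 * (p*r + q*s) + q\<^sup>2 * (p*s + q*r))"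
      by (simp_all add: power2_eq_square algebra_simps)
    then have "(p*s - q*r) * (p*s + q*r) * (p*r + q*s) = 0"
      and "(p*s - q*r) * (p*s + q*r) * (p*s + q*r) = 0"
      by (simp_all only: e0010 e1011 mult_zero_right diff_self)
    then have z: "p*s + q*r = 0" and nz: "p*r + q*s \<noteq> 0" using False ne by auto
    then have "p = 0" "r = 0" using e0010 e1011 by auto
    then show False using ne by simp
  qed
qed

lemma CNOT1_not_homogeneously_pfaffian:
  assumes A: "A \<in> carrier_mat 2 2" and inv: "invertible_mat A"
  shows "\<not> pfaffian_under [A, A, A, A] CNOT1"
proof
  assume pf: "pfaffian_under [A, A, A, A] CNOT1"
  have zero: "tensor_apply [A, A, A, A] CNOT1 (indicator_string 4 I) = 0"
    if "I \<subseteq> {..<4}" "odd (card I)" for I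
  proof -
    have len: "length [A, A, A, A] = 4" by simp
    show ?thesis using pfaffian_under_imp_odd_zero[OF pf, unfolded len] that .
  qed
  have str: "indicator_string 4 {2} = [0,0,1,0]" "indicator_string 4 {0,2,3} = [1,0,1,1]"
    "indicator_string 4 {3} = [0,0,0,1]" "indicator_string 4 {1,2,3} = [0,1,1,1]"
    by (simp_all add: indicator_string_def upt_conv_Cons)
  have "A $$ (0,0) * A $$ (1,1) = A $$ (0,1) * A $$ (1,0)"
    using zero[of "{2}"] zero[of "{0,2,3}"] zero[of "{3}"] zero[of "{1,2,3}"]
    by (intro odd_coefficients_force_singular)
       (simp_all add: str tensor_apply_CNOT1 power2_eq_square algebra_simps del: One_nat_def)
  then show False using inv A by (simp add: invertible_mat_2x2_iff)
qed

section \<open>A heterogeneous basis change\<close>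

text \<open>
  The rows of these matrices are left eigenvectors of $X$, $Z$, $Y$ and $-Y$ respectively, for the
  eigenvalues 1 and -1 in this order, except that the second row for $Z$ is scaled by the imaginary
  unit to make all coefficients of the transformed gate real. The order of the eigenvalues makes the
  surviving coefficients the even ones; swapping the rows on a single wire would leave the odd ones.
\<close>
definition control_in :: "complex mat" where
  "control_in = mat_of_rows_list 2 [[1, 1], [1, -1]]"

definition target_in :: "complex mat" where
  "target_in = mat_of_rows_list 2 [[1, 0], [0, \<i>]]"

definition target_out :: "complex mat" where
  "target_out = mat_of_rows_list 2 [[1, -\<i>], [1, \<i>]]"

definition control_out :: "complex mat" where
  "control_out = mat_of_rows_list 2 [[1, \<i>], [1, -\<i>]]"

text \<open>The quadratic coefficients of the transformed gate, divided by its empty coefficient 2.\<close>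
definition CNOT1_skew :: "complex mat" where
  "CNOT1_skew = mat_of_rows_list 4
    [[0, 1, 1, 1], [-1, 0, -1, 1], [-1, 1, 0, 1], [-1, -1, -1, 0]]"

lemmas basis_change_defs = control_in_def target_in_def target_out_def control_out_def

lemma basis_change_carrier:
  "control_in \<in> carrier_mat 2 2" "target_in \<in> carrier_mat 2 2"
  "target_out \<in> carrier_mat 2 2" "control_out \<in> carrier_mat 2 2"
  by (auto simp: basis_change_defs mat_of_rows_list_def)

lemma basis_change_invertible:
  "invertible_mat control_in" "invertible_mat target_in"
  "invertible_mat target_out" "invertible_mat control_out"
  by (simp_all add: invertible_mat_2x2_iff basis_change_carrier)
     (simp_all add: basis_change_defs mat_of_rows_list_def)

lemma CNOT1_skew_dim: "CNOT1_skew \<in> carrier_mat 4 4"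
  by (auto simp: CNOT1_skew_def mat_of_rows_list_def)

lemma CNOT1_skew_skew_symmetric: "skew_symmetric CNOT1_skew"
  unfolding skew_symmetric_def
  by (auto intro!: eq_matI simp: CNOT1_skew_def mat_of_rows_list_def eval_nat_numeral less_Suc_eq)

lemma CNOT1_heterogeneously_pfaffian:
  "pfaffian_under [control_in, target_in, target_out, control_out] CNOT1"
proof -
  let ?As = "[control_in, target_in, target_out, control_out]"
  let ?M = CNOT1_skew
  have len: "length ?As = 4" by simp
  have dim: "dim_row ?M = 4" using CNOT1_skew_dim by simp
  have quartic: "sPf ?M (indicator_string 4 {0,1,2,3}) = -1"
  proof -
    have "square_mat ?M" using CNOT1_skew_skew_symmetric by (simp add: skew_symmetric_def)
    moreover have "{..<4} = {0,1,2,3::nat}" by auto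
    ultimately have "sPf ?M (indicator_string 4 {0,1,2,3}) = Pf ?M"
      using sPf_full[of ?M] dim by simp
    also have "\<dots> = -1"
      unfolding Pf_dim_4[OF dim CNOT1_skew_skew_symmetric]
      by (simp add: CNOT1_skew_def mat_of_rows_list_def)
    finally show ?thesis .
  qed
  have quadratic: "sPf ?M (indicator_string 4 {i,j}) = ?M $$ (i,j)" if "i < j" "j < 4" for i j
    using sPf_pair[OF CNOT1_skew_skew_symmetric] dim that by simp
  have odd: "sPf ?M (indicator_string 4 I) = 0" if "I \<subseteq> {..<4}" "odd (card I)" for I
    using sPf_odd[of I ?M] dim that by simp
  have bits: "tensor_apply ?As CNOT1 (indicator_string 4 I) = tensor_apply ?As CNOT1
      [of_bool (0 \<in> I), of_bool (1 \<in> I), of_bool (2 \<in> I), of_bool (3 \<in> I)]" for I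
    by (simp add: indicator_string_def upt_conv_Cons numeral_2_eq_2 numeral_3_eq_3)
  have "\<forall>I\<in>Pow {0,1,2,3}.
      tensor_apply ?As CNOT1 (indicator_string 4 I) = 2 * sPf ?M (indicator_string 4 I)"
    by (simp add: Pow_insert bits tensor_apply_CNOT1 sPf_empty[of ?M, unfolded dim] odd quadratic
        quartic[unfolded One_nat_def])
      (simp add: basis_change_defs CNOT1_skew_def mat_of_rows_list_def)
  moreover have "{..<4} = {0,1,2,3::nat}" by auto
  ultimately have coeff: "tensor_apply ?As CNOT1 (indicator_string 4 I)
      = 2 * sPf ?M (indicator_string 4 I)" if "I \<subseteq> {..<4}" for I
    using that by simp
  have "tensor_apply ?As CNOT1 = (\<lambda>x. 2 * sPf ?M x)"
  proof
    fix x show "tensor_apply ?As CNOT1 x = 2 * sPf ?M x"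
    proof (cases "x \<in> bitstrings 4")
      case True
      then show ?thesis using coeff by (auto simp: bitstrings_eq_indicator_strings)
    next
      case False
      have "tensor_apply ?As CNOT1 x = 0" unfolding tensor_apply_def len using False by simp
      then show ?thesis using False dim by (simp add: sPf_outside_bitstrings)
    qed
  qed
  then have "\<exists>\<alpha> \<Xi>. \<Xi> \<in> carrier_mat 4 4 \<and> skew_symmetric \<Xi> \<and>
      tensor_apply ?As CNOT1 = (\<lambda>x. \<alpha> * sPf \<Xi> x)"
    using CNOT1_skew_dim CNOT1_skew_skew_symmetric by blast
  moreover have "\<forall>N\<in>set ?As. N \<in> carrier_mat 2 2" using basis_change_carrier by simp
  ultimately show ?thesis
    unfolding pfaffian_under_def len using CNOT1_in_gates by blast
qed

theorem theorem7:
  shows "(\<not> (\<exists>A \<in> carrier_mat 2 2. invertible_mat A \<and> pfaffian_under [A, A, A, A] CNOT1)) \<and>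
    (\<exists>A \<in> carrier_mat 2 2. \<exists>B \<in> carrier_mat 2 2. \<exists>C \<in> carrier_mat 2 2. \<exists>D \<in> carrier_mat 2 2.
       invertible_mat A \<and> invertible_mat B \<and> invertible_mat C \<and> invertible_mat D \<and>
       pfaffian_under [A, B, C, D] CNOT1)"
proof (intro conjI)
  show "\<not> (\<exists>A \<in> carrier_mat 2 2. invertible_mat A \<and> pfaffian_under [A, A, A, A] CNOT1)"
    using CNOT1_not_homogeneously_pfaffian by blast
  show "\<exists>A \<in> carrier_mat 2 2. \<exists>B \<in> carrier_mat 2 2. \<exists>C \<in> carrier_mat 2 2. \<exists>D \<in> carrier_mat 2 2.
      invertible_mat A \<and> invertible_mat B \<and> invertible_mat C \<and> invertible_mat D \<and>
      pfaffian_under [A, B, C, D] CNOT1"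
    by (intro bexI conjI)
      (rule basis_change_invertible CNOT1_heterogeneously_pfaffian basis_change_carrier)+
qed

end
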